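(* Let $\mathcal{A}\in\mathbb{R}^{m_1\times n_1\times n_3}$, $\mathcal{X}\in\mathbb{R}^{n_1\times n_2\times n_3}$, $\mathcal{B}\in\mathbb{R}^{m_2\times n_2\times n_3}$ be real tensors. Then $$\|\mathcal{A}*\mathcal{X}*\mathcal{B}^T\|\le\frac12\|\mathcal{A}^T*\mathcal{A}*\mathcal{X}+\mathcal{X}*\mathcal{B}^T*\mathcal{B}\|$$ holds both for $\|\cdot\|$ the Frobenius norm $\|\cdot\|_F$ and for $\|\cdot\|$ the spectral norm $\|\cdot\|_2$.
   Context: For $\mathcal{A}\in\mathbb{R}^{n_1\times n_2\times n_3}$ with frontal slices $A^{(1)},\dots,A^{(n_3)}$ (each $n_1\times n_2$), $\mathrm{bcirc}(\mathcal{A})$ is the $n_1n_3\times n_2n_3$ block circulant matrix whose first block column is $A^{(1)},A^{(2)},\dots,A^{(n_3)}$ (top to bottom), i.e. its $(i,j)$ block is $A^{(((i-j)\bmod n_3)+1)}$. $\mathrm{unfold}(\mathcal{A})$ is the first block column of $\mathrm{bcirc}(\mathcal{A})$ and $\mathrm{fold}$ is its inverse. The t-product of $\mathcal{A}\in\mathbb{R}^{n_1\times n_2\times n_3}$ and $\mathcal{B}\in\mathbb{R}^{n_2\times n_4\times n_3}$ is $\mathcal{A}*\mathcal{B}=\mathrm{fold}(\mathrm{bcirc}(\mathcal{A})\cdot\mathrm{unfold}(\mathcal{B}))\in\mathbb{R}^{n_1\times n_4\times n_3}$. The transpose $\mathcal{A}^{T}$ is obtained by transposing each frontal slice and reversing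 the order of the transposed slices $2,\dots,n_3$. Norms: $\|\mathcal{A}\|_F=\sqrt{\sum_{i,j,k}|a_{ijk}|^2}$ and $\|\mathcal{A}\|_2=\|\mathrm{bcirc}(\mathcal{A})\|_2$ (matrix spectral norm). *)

theory Defs
  imports "HOL-Analysis.Analysis"
begin

text \<open>
  A tensor of format \<open>n1 \<times> n2 \<times> n3\<close> is the vector of its \<open>n3\<close> frontal slices: the entry
  \<open>a_ijk\<close> of \<open>A\<close> is \<open>A $ k $ i $ j\<close>. The slices are ordered by the linear order on
  the index type \<open>'n3\<close>; every size \<open>n3 \<ge> 1\<close> occurs, e.g. through the numeral types.
\<close>

type_synonym ('n1, 'n2, 'n3) tensor = "(((real, 'n2) vec, 'n1) vec, 'n3) vec"

definition pos :: "'k::{finite,linorder} \<Rightarrow> nat" where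
  "pos k = card {l. l < k}"

text \<open>Slices are numbered from \<open>0\<close>, so \<open>slice A k\<close> is the classical \<open>A^(k+1)\<close>.\<close>

definition slice :: "('n1::finite, 'n2::finite, 'n3::{finite,linorder}) tensor \<Rightarrow> nat \<Rightarrow> real^'n2^'n1" where
  "slice A k = A $ (inv pos k)"

text \<open>Rows and columns of a block matrix are indexed by pairs (block, index within the block).
  Adding \<open>CARD('n3)\<close> before subtracting avoids truncated subtraction.\<close>

definition bcirc :: "('n1::finite, 'n2::finite, 'n3::{finite,linorder}) tensor \<Rightarrow> real^('n3 \<times> 'n2)^('n3 \<times> 'n1)" where
  "bcirc A = (\<chi> r c. slice A ((pos (fst r) + CARD('n3) - pos (fst c)) mod CARD('n3)) $ snd r $ snd c)"

definition tunfold :: "('n1::finite, 'n2::finite, 'n3::{finite,linorder}) tensor \<Rightarrow> real^'n2^('n3 \<times> 'n1)" where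
  "tunfold A = (\<chi> r j. A $ fst r $ snd r $ j)"

definition tfold :: "real^'n2^('n3 \<times> 'n1) \<Rightarrow> ('n1::finite, 'n2::finite, 'n3::{finite,linorder}) tensor" where
  "tfold M = (\<chi> k i j. M $ (k, i) $ j)"

definition tprod :: "('n1::finite, 'n2::finite, 'n3::{finite,linorder}) tensor \<Rightarrow> ('n2, 'n4::finite, 'n3) tensor
    \<Rightarrow> ('n1, 'n4, 'n3) tensor" (infixl "*\<^sub>t" 70) where
  "A *\<^sub>t B = tfold (bcirc A ** tunfold B)"

definition ttranspose :: "('n1::finite, 'n2::finite, 'n3::{finite,linorder}) tensor \<Rightarrow> ('n2, 'n1, 'n3) tensor" where
  "ttranspose A = (\<chi> k. transpose (if pos k = 0 then slice A 0 else slice A (CARD('n3) - pos k)))"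

definition frobenius_norm :: "('n1::finite, 'n2::finite, 'n3::{finite,linorder}) tensor \<Rightarrow> real" where
  "frobenius_norm A = sqrt (\<Sum>i\<in>UNIV. \<Sum>j\<in>UNIV. \<Sum>k\<in>UNIV. \<bar>A $ k $ i $ j\<bar>\<^sup>2)"

text \<open>The matrix spectral norm is the operator norm with respect to the Euclidean norms.\<close>

definition spectral_norm :: "('n1::finite, 'n2::finite, 'n3::{finite,linorder}) tensor \<Rightarrow> real" where
  "spectral_norm A = onorm (\<lambda>x. bcirc A *v x)"

lemma pos_less: "pos (k::'k::{finite,linorder}) < CARD('k)"
  unfolding pos_def by (rule psubset_card_mono) auto

lemma pos_strict_mono: "k < l \<Longrightarrow> pos k < pos (l::'k::{finite,linorder})"
  unfolding pos_def by (rule psubset_card_mono) auto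

lemma inj_pos: "inj (pos :: 'k::{finite,linorder} \<Rightarrow> nat)"
proof (rule injI)
  fix k l :: 'k
  assume "pos k = pos l"
  then show "k = l"
    using pos_strict_mono[of k l] pos_strict_mono[of l k] by (cases k l rule: linorder_cases) auto
qed

lemma bij_betw_pos: "bij_betw pos (UNIV :: 'k::{finite,linorder} set) {..<CARD('k)}"
proof -
  have "range (pos :: 'k \<Rightarrow> nat) = {..<CARD('k)}"
    by (rule card_subset_eq) (auto simp: pos_less card_image[OF inj_pos])
  then show ?thesis
    using inj_pos by (simp add: bij_betw_def)
qed

lemma slice_pos [simp]: "slice A (pos k) = A $ k"
  by (simp add: slice_def inj_pos)

text \<open>\<open>tunfold\<close> is the first block column of \<open>bcirc\<close>, and \<open>tfold\<close> is its inverse.\<close>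

lemma tunfold_eq_first_block_column:
  fixes A :: "('n1::finite, 'n2::finite, 'n3::{finite,linorder}) tensor"
  assumes "pos (k0::'n3) = 0"
  shows "tunfold A $ r $ j = bcirc A $ r $ (k0, j)"
  using assms by (simp add: tunfold_def bcirc_def pos_less)

lemma tfold_tunfold [simp]: "tfold (tunfold A) = A"
  by (simp add: tfold_def tunfold_def vec_eq_iff)

lemma tunfold_tfold [simp]: "tunfold (tfold M) = M"
  by (simp add: tfold_def tunfold_def vec_eq_iff)

end

theory Submission
  imports Defs
begin

text \<open>
  The map \<^const>\<open>bcirc\<close> is additive and multiplicative, takes the tensor transpose to the
  matrix transpose, and multiplies the Frobenius norm by the constant \<open>\<surd>n3\<close>. Both
  inequalities are thereby statements about real matrices \<open>A\<close>, \<open>X\<close>, \<open>B\<close>.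
  Write \<open>P = A\<^sup>T A\<close> and \<open>Q = B\<^sup>T B\<close>.

  For the Frobenius norm, moving factors across the inner product gives
  \<open>\<parallel>A X B\<^sup>T\<parallel>\<^sup>2 = (P X) \<bullet> (X Q)\<close>, and \<open>4 (u \<bullet> v) \<le> \<parallel>u + v\<parallel>\<^sup>2\<close> holds in every inner product space.

  For the spectral norm, let \<open>\<sigma> = \<parallel>A X B\<^sup>T\<parallel>\<close> be positive and take singular vectors,
  \<open>A X B\<^sup>T v = \<sigma> u\<close> and \<open>B X\<^sup>T A\<^sup>T u = \<sigma> v\<close>. The vectors \<open>p = X B\<^sup>T v\<close> and
  \<open>q = X\<^sup>T A\<^sup>T u\<close> satisfy \<open>X Q q = \<sigma> p\<close> and \<open>X\<^sup>T P p = \<sigma> q\<close>: the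
  pair \<open>(p, q)\<close> is an eigenvector of a product of two symmetric block matrices. Hence
  \<open>p \<bullet> (P X + X Q) q = \<sigma> (\<parallel>p\<parallel>\<^sup>2 + \<parallel>q\<parallel>\<^sup>2) \<ge> 2 \<sigma> \<parallel>p\<parallel> \<parallel>q\<parallel>\<close>, while the left-hand side is
  at most \<open>\<parallel>P X + X Q\<parallel> \<parallel>p\<parallel> \<parallel>q\<parallel>\<close>.
\<close>

section \<open>Matrix inequalities\<close>

lemma inner_matrix_mult_left:
  fixes A :: "real^'n^'m" and X :: "real^'k^'n"
  shows "(A ** X) \<bullet> Y = X \<bullet> (transpose A ** Y)"
proof -
  have "(A ** X) \<bullet> Y = (\<Sum>i\<in>UNIV. \<Sum>j\<in>UNIV. \<Sum>l\<in>UNIV. A$i$l * X$l$j * Y$i$j)"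
    by (simp add: inner_vec_def matrix_matrix_mult_def sum_distrib_right)
  also have "\<dots> = (\<Sum>j\<in>UNIV. \<Sum>i\<in>UNIV. \<Sum>l\<in>UNIV. A$i$l * X$l$j * Y$i$j)"
    by (rule sum.swap)
  also have "\<dots> = (\<Sum>j\<in>UNIV. \<Sum>l\<in>UNIV. \<Sum>i\<in>UNIV. A$i$l * X$l$j * Y$i$j)"
    by (intro sum.cong refl sum.swap)
  also have "\<dots> = (\<Sum>l\<in>UNIV. \<Sum>j\<in>UNIV. \<Sum>i\<in>UNIV. A$i$l * X$l$j * Y$i$j)"
    by (rule sum.swap)
  also have "\<dots> = X \<bullet> (transpose A ** Y)"
    by (simp add: inner_vec_def matrix_matrix_mult_def transpose_def sum_distrib_left mult_ac)
  finally show ?thesis .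
qed

lemma inner_transpose_transpose:
  fixes A B :: "real^'n^'m"
  shows "transpose A \<bullet> transpose B = A \<bullet> B"
  unfolding inner_vec_def transpose_def by (simp, rule sum.swap)

lemma inner_matrix_mult_right:
  fixes B :: "real^'k^'n" and X :: "real^'n^'m"
  shows "(X ** B) \<bullet> Y = X \<bullet> (Y ** transpose B)"
proof -
  have "(X ** B) \<bullet> Y = (transpose B ** transpose X) \<bullet> transpose Y"
    by (simp add: inner_transpose_transpose flip: matrix_transpose_mul)
  also have "\<dots> = transpose X \<bullet> (B ** transpose Y)"
    by (simp add: inner_matrix_mult_left)
  also have "\<dots> = transpose X \<bullet> transpose (Y ** transpose B)"
    by (simp add: matrix_transpose_mul)
  finally show ?thesis
    by (simp only: inner_transpose_transpose)
qed

lemma norm_matrix_arith_geo_mean: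
  fixes A :: "real^'n1^'m1" and X :: "real^'n2^'n1" and B :: "real^'n2^'m2"
  shows "norm (A ** X ** transpose B) \<le> 1 / 2 * norm (transpose A ** A ** X + X ** transpose B ** B)"
proof -
  let ?U = "transpose A ** A ** X" and ?V = "X ** transpose B ** B"
  have "(A ** X ** transpose B) \<bullet> (A ** X ** transpose B) = X \<bullet> (transpose A ** (A ** X ** transpose B ** B))"
    by (subst inner_matrix_mult_right, subst inner_matrix_mult_left) (simp only: transpose_transpose)
  also have "\<dots> = X \<bullet> (?U ** transpose B ** B)"
    by (simp only: matrix_mul_assoc)
  also have "\<dots> = ?V \<bullet> ?U"
    by (subst inner_matrix_mult_right, subst inner_matrix_mult_right)
      (simp only: transpose_transpose matrix_mul_assoc)
  finally have "(A ** X ** transpose B) \<bullet> (A ** X ** transpose B) = ?U \<bullet> ?V"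
    by (simp only: inner_commute)
  then have "(2 * norm (A ** X ** transpose B))\<^sup>2 = 4 * (?U \<bullet> ?V)"
    by (simp add: power2_norm_eq_inner power_mult_distrib)
  also have "\<dots> \<le> (norm (?U + ?V))\<^sup>2"
    using inner_ge_zero[of "?U - ?V"]
    by (simp add: power2_norm_eq_inner inner_diff_left inner_diff_right inner_add_left
        inner_add_right inner_commute)
  finally have "2 * norm (A ** X ** transpose B) \<le> norm (?U + ?V)"
    by (rule power2_le_imp_le) simp
  then show ?thesis by simp
qed

lemma inner_transpose_mult_vector:
  fixes M :: "real^'n^'m"
  shows "(transpose M *v x) \<bullet> y = x \<bullet> (M *v y)"
  by (simp add: dot_lmul_matrix)

lemma matrix_onorm_attained:
  fixes M :: "real^'n^'m"
  obtains v where "norm v = 1" and "norm (M *v v) = onorm ((*v) M)"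
proof -
  have "\<exists>v\<in>sphere 0 1. \<forall>y\<in>sphere 0 1. norm (M *v y) \<le> norm (M *v v)"
    by (intro continuous_attains_sup continuous_intros linear_continuous_on
        bounded_linear.linear matrix_vector_mul_bounded_linear compact_sphere)
      auto
  then obtain v where v: "norm v = 1" and max: "\<And>y. norm y = 1 \<Longrightarrow> norm (M *v y) \<le> norm (M *v v)"
    by auto
  have "norm (M *v y) \<le> norm (M *v v) * norm y" for y
  proof (cases "y = 0")
    case False
    then have "norm (M *v ((1 / norm y) *\<^sub>R y)) \<le> norm (M *v v)"
      by (intro max) simp
    with False show ?thesis
      by (simp add: matrix_vector_mult_scaleR divide_simps)
  qed simp
  then have "onorm ((*v) M) \<le> norm (M *v v)"
    by (rule onorm_le)
  moreover have "norm (M *v v) \<le> onorm ((*v) M)"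
    using onorm[OF matrix_vector_mul_bounded_linear, of M v] v by simp
  ultimately show ?thesis
    using that v by simp
qed

text \<open>With \<open>z = M\<^sup>T y\<close>, this is \<open>\<parallel>z\<parallel>\<^sup>2 = y \<bullet> M z \<le> \<parallel>y\<parallel> \<parallel>M\<parallel> \<parallel>z\<parallel>\<close>.\<close>

lemma norm_transpose_mult_vector_le:
  fixes M :: "real^'n^'m"
  shows "norm (transpose M *v y) \<le> onorm ((*v) M) * norm y"
proof (cases "transpose M *v y = 0")
  case False
  let ?z = "transpose M *v y"
  have "norm ?z * norm ?z = y \<bullet> (M *v ?z)"
    by (simp only: inner_transpose_mult_vector[symmetric] flip: power2_norm_eq_inner power2_eq_square)
  also have "\<dots> \<le> norm y * norm (M *v ?z)"
    by (rule norm_cauchy_schwarz)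
  also have "\<dots> \<le> norm y * (onorm ((*v) M) * norm ?z)"
    by (intro mult_left_mono onorm matrix_vector_mul_bounded_linear) simp
  finally have "norm ?z * norm ?z \<le> (onorm ((*v) M) * norm y) * norm ?z"
    by (simp add: mult_ac)
  with False show ?thesis by simp
qed (simp add: onorm_pos_le[OF matrix_vector_mul_bounded_linear])

text \<open>
  A unit vector \<open>v\<close> at which the norm \<open>\<sigma>\<close> is attained is an eigenvector of \<open>M\<^sup>T M\<close>:
  expanding \<open>\<parallel>M\<^sup>T M v - \<sigma>\<^sup>2 v\<parallel>\<^sup>2\<close> gives at most \<open>\<sigma>\<^sup>4 - 2 \<sigma>\<^sup>4 + \<sigma>\<^sup>4\<close>.
\<close>

lemma top_singular_vectors:
  fixes M :: "real^'n^'m"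
  assumes pos: "onorm ((*v) M) > 0"
  obtains u v where "norm u = 1" and "norm v = 1"
    and "M *v v = onorm ((*v) M) *\<^sub>R u" and "transpose M *v u = onorm ((*v) M) *\<^sub>R v"
proof -
  define s where "s = onorm ((*v) M)"
  have s: "s > 0" using pos by (simp add: s_def)
  obtain v where v: "norm v = 1" and Mv: "norm (M *v v) = s"
    using matrix_onorm_attained[of M] by (auto simp: s_def)
  define w where "w = transpose M *v (M *v v)"
  have wv: "w \<bullet> v = s\<^sup>2"
    by (simp only: w_def inner_transpose_mult_vector flip: Mv power2_norm_eq_inner)
  have "norm w \<le> s * s"
    using norm_transpose_mult_vector_le[of M "M *v v"] by (simp add: w_def s_def Mv[unfolded s_def])
  then have ww: "w \<bullet> w \<le> (s * s)\<^sup>2"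
    unfolding power2_norm_eq_inner[symmetric] by (intro power_mono) auto
  have vv: "v \<bullet> v = 1"
    using v by (simp add: norm_eq_1)
  have "(w - s\<^sup>2 *\<^sub>R v) \<bullet> (w - s\<^sup>2 *\<^sub>R v) = w \<bullet> w - 2 * s\<^sup>2 * (w \<bullet> v) + s\<^sup>2 * s\<^sup>2 * (v \<bullet> v)"
    by (simp add: inner_diff_left inner_diff_right inner_commute algebra_simps)
  also have "\<dots> \<le> 0"
    using ww by (simp add: wv vv power2_eq_square algebra_simps)
  finally have "w - s\<^sup>2 *\<^sub>R v = 0"
    using inner_gt_zero_iff[of "w - s\<^sup>2 *\<^sub>R v"] by linarith
  then have "w = s\<^sup>2 *\<^sub>R v"
    by simp
  then have "transpose M *v ((1 / s) *\<^sub>R (M *v v)) = s *\<^sub>R v"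
    using s by (simp only: matrix_vector_mult_scaleR flip: w_def) (simp add: power2_eq_square)
  moreover have "norm ((1 / s) *\<^sub>R (M *v v)) = 1" "M *v v = s *\<^sub>R ((1 / s) *\<^sub>R (M *v v))"
    using s Mv by auto
  ultimately show ?thesis
    using that v unfolding s_def by blast
qed

text \<open>
  The vectors \<open>u\<close>, \<open>v\<close> live in the outer spaces of \<open>A\<close> and \<open>B\<close>, on which
  \<open>A\<^sup>T A X + X B\<^sup>T B\<close> does not act; \<open>p\<close> and \<open>q\<close> carry the singular value to the
  spaces on which it does. Both are nonzero because \<open>A p = \<sigma> u\<close> and \<open>B q = \<sigma> v\<close>.
\<close>

lemma onorm_matrix_arith_geo_mean:
  fixes A :: "real^'n1^'m1" and X :: "real^'n2^'n1" and B :: "real^'n2^'m2"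
  shows "onorm ((*v) (A ** X ** transpose B))
    \<le> 1 / 2 * onorm ((*v) (transpose A ** A ** X + X ** transpose B ** B))"
proof -
  let ?M = "A ** X ** transpose B" and ?N = "transpose A ** A ** X + X ** transpose B ** B"
  define s where "s = onorm ((*v) ?M)"
  define t where "t = onorm ((*v) ?N)"
  have t: "t \<ge> 0"
    by (simp add: t_def onorm_pos_le[OF matrix_vector_mul_bounded_linear])
  have "2 * s \<le> t"
  proof (cases "s > 0")
    case True
    then obtain u v where u: "norm u = 1" and v: "norm v = 1"
      and Mv: "?M *v v = s *\<^sub>R u" and Mu: "transpose ?M *v u = s *\<^sub>R v"
      using top_singular_vectors[of ?M] by (auto simp: s_def)
    define p where "p = X *v (transpose B *v v)"
    define q where "q = transpose X *v (transpose A *v u)"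
    have Ap: "A *v p = s *\<^sub>R u"
      using Mv by (simp add: p_def matrix_vector_mul_assoc matrix_mul_assoc del: transpose_matrix_vector)
    have Bq: "B *v q = s *\<^sub>R v"
      using Mu by (simp add: q_def matrix_vector_mul_assoc matrix_mul_assoc matrix_transpose_mul
          del: transpose_matrix_vector)
    have "p \<noteq> 0" using Ap True u by auto
    moreover have "q \<noteq> 0" using Bq True v by auto
    ultimately have pq: "norm p * norm q > 0" by simp
    have "p \<bullet> ((transpose A ** A ** X) *v q) = (A *v p) \<bullet> (A *v (X *v q))"
      by (metis inner_commute inner_transpose_mult_vector matrix_vector_mul_assoc)
    also have "\<dots> = s * (u \<bullet> (A *v (X *v q)))"
      by (simp add: Ap)
    also have "\<dots> = s * (norm q)\<^sup>2"
      by (simp only: inner_transpose_mult_vector[symmetric] flip: q_def power2_norm_eq_inner)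
    finally have Pq: "p \<bullet> ((transpose A ** A ** X) *v q) = s * (norm q)\<^sup>2" .
    have "(X ** transpose B ** B) *v q = X *v (transpose B *v (B *v q))"
      by (simp add: matrix_vector_mul_assoc matrix_mul_assoc del: transpose_matrix_vector)
    also have "\<dots> = s *\<^sub>R p"
      by (simp only: Bq p_def matrix_vector_mult_scaleR)
    finally have Qq: "p \<bullet> ((X ** transpose B ** B) *v q) = s * (norm p)\<^sup>2"
      by (simp add: power2_norm_eq_inner)
    \<comment> \<open>Estimating \<open>p \<bullet> (?N *v q)\<close> from both sides leaves the factor \<open>\<parallel>p\<parallel> \<parallel>q\<parallel>\<close> to cancel.\<close>
    have "2 * s * (norm p * norm q) \<le> s * ((norm p)\<^sup>2 + (norm q)\<^sup>2)"
      using True sum_squares_bound[of "norm p" "norm q"] by (simp add: mult_ac)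
    also have "\<dots> = p \<bullet> (?N *v q)"
      by (simp add: matrix_vector_mult_add_rdistrib inner_add_right Pq Qq distrib_left)
    also have "\<dots> \<le> norm p * norm (?N *v q)"
      by (rule norm_cauchy_schwarz)
    also have "\<dots> \<le> norm p * (t * norm q)"
      unfolding t_def by (intro mult_left_mono onorm matrix_vector_mul_bounded_linear) simp
    finally have "2 * s * (norm p * norm q) \<le> t * (norm p * norm q)"
      by (simp add: mult_ac)
    with pq show ?thesis
      by (rule mult_right_le_imp_le[rotated])
  qed (use t in simp)
  then show ?thesis
    by (simp add: s_def t_def)
qed

section \<open>Block circulant matrices\<close>

text \<open>
  Subtraction of the cyclic group of order \<open>n3\<close>, transported to the slice indices along
  \<^const>\<open>pos\<close>.
\<close>

definition cyclic_diff :: "'k::{finite,linorder} \<Rightarrow> 'k \<Rightarrow> 'k" where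
  "cyclic_diff k l = inv pos ((pos k + CARD('k) - pos l) mod CARD('k))"

lemma pos_inv_pos: "n < CARD('k) \<Longrightarrow> pos (inv pos n :: 'k::{finite,linorder}) = n"
  using bij_betw_pos[where 'k = 'k] by (intro f_inv_into_f) (auto simp: bij_betw_def)

text \<open>A case distinction in place of the remainder leaves only linear arithmetic.\<close>

lemma pos_cyclic_diff:
  fixes k l :: "'k::{finite,linorder}"
  shows "pos (cyclic_diff k l)
    = (if pos l \<le> pos k then pos k - pos l else pos k + CARD('k) - pos l)"
  using pos_less[of k] pos_less[of l]
  by (auto simp: cyclic_diff_def pos_inv_pos mod_if)

text \<open>
  Invariance under a common shift lets the product of two block circulant matrices be reindexed to
  the first block column, so that \<^const>\<open>bcirc\<close> is multiplicative.
\<close>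

lemma cyclic_diff_cancel: "cyclic_diff (cyclic_diff k m) (cyclic_diff l m) = cyclic_diff k l"
  using pos_less[of k] pos_less[of l] pos_less[of m]
  by (intro injD[OF inj_pos]) (auto simp: pos_cyclic_diff)

lemma bij_cyclic_diff: "bij (\<lambda>k :: 'k::{finite,linorder}. cyclic_diff k l)"
proof -
  have "inj (\<lambda>k :: 'k. cyclic_diff k l)"
  proof (rule injI)
    fix k k' :: 'k
    assume "cyclic_diff k l = cyclic_diff k' l"
    then have "pos (cyclic_diff k l) = pos (cyclic_diff k' l)" by simp
    then have "pos k = pos k'"
      using pos_less[of k] pos_less[of k'] pos_less[of l]
      by (auto simp: pos_cyclic_diff split: if_splits)
    then show "k = k'"
      by (rule injD[OF inj_pos])
  qed
  then show ?thesis
    by (simp add: bij_def finite_UNIV_inj_surj)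
qed

lemma bcirc_nth: "bcirc A $ (k, i) $ (l, j) = A $ cyclic_diff k l $ i $ j"
  by (simp add: bcirc_def slice_def cyclic_diff_def)

lemma bcirc_add: "bcirc (A + B) = bcirc A + bcirc B"
  by (simp add: vec_eq_iff split_paired_all bcirc_nth)

lemma sum_UNIV_prod: "(\<Sum>r\<in>UNIV. f r) = (\<Sum>k\<in>UNIV. \<Sum>i\<in>UNIV. f (k, i))"
  by (simp add: sum.cartesian_product flip: UNIV_Times_UNIV)

lemma tprod_nth:
  "(A *\<^sub>t B) $ k $ i $ j = (\<Sum>l\<in>UNIV. \<Sum>h\<in>UNIV. A $ cyclic_diff k l $ i $ h * B $ l $ h $ j)"
  by (simp add: tprod_def tfold_def tunfold_def matrix_matrix_mult_def bcirc_nth sum_UNIV_prod)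

lemma bcirc_tprod: "bcirc (A *\<^sub>t B) = bcirc A ** bcirc B"
proof -
  have "(\<Sum>l\<in>UNIV. \<Sum>h\<in>UNIV. A $ cyclic_diff (cyclic_diff k m) l $ i $ h * B $ l $ h $ j)
      = (\<Sum>l\<in>UNIV. \<Sum>h\<in>UNIV. A $ cyclic_diff k l $ i $ h * B $ cyclic_diff l m $ h $ j)" for k m i j
    by (subst sum.reindex_bij_betw[OF bij_cyclic_diff[of m], symmetric])
      (simp add: cyclic_diff_cancel)
  then show ?thesis
    by (simp add: vec_eq_iff split_paired_all bcirc_nth tprod_nth matrix_matrix_mult_def sum_UNIV_prod)
qed

lemma ttranspose_nth_cyclic_diff:
  fixes A :: "('n1::finite, 'n2::finite, 'n3::{finite,linorder}) tensor"
  shows "ttranspose A $ cyclic_diff k l = transpose (A $ cyclic_diff l k)"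
proof -
  let ?d = "pos (cyclic_diff k l)"
  have "(if ?d = 0 then 0 else CARD('n3) - ?d) = pos (cyclic_diff l k)"
    using pos_less[of k] pos_less[of l] by (auto simp: pos_cyclic_diff)
  then have "(if ?d = 0 then slice A 0 else slice A (CARD('n3) - ?d)) = slice A (pos (cyclic_diff l k))"
    by (metis (full_types))
  then show ?thesis
    by (simp only: ttranspose_def vec_lambda_beta slice_pos)
qed

lemma bcirc_ttranspose: "bcirc (ttranspose A) = transpose (bcirc A)"
  by (simp add: vec_eq_iff split_paired_all bcirc_nth ttranspose_nth_cyclic_diff transpose_def)

lemma frobenius_norm_eq_norm: "frobenius_norm A = norm A"
proof -
  have "(\<Sum>i\<in>UNIV. \<Sum>j\<in>UNIV. \<Sum>k\<in>UNIV. \<bar>A $ k $ i $ j\<bar>\<^sup>2)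
      = (\<Sum>i\<in>UNIV. \<Sum>k\<in>UNIV. \<Sum>j\<in>UNIV. \<bar>A $ k $ i $ j\<bar>\<^sup>2)"
    by (intro sum.cong refl sum.swap)
  also have "\<dots> = (\<Sum>k\<in>UNIV. \<Sum>i\<in>UNIV. \<Sum>j\<in>UNIV. \<bar>A $ k $ i $ j\<bar>\<^sup>2)"
    by (rule sum.swap)
  finally show ?thesis
    by (simp add: frobenius_norm_def norm_eq_sqrt_inner inner_vec_def power2_eq_square)
qed

text \<open>Every slice occurs once in each of the \<open>n3\<close> block columns.\<close>

lemma norm_bcirc:
  fixes A :: "('n1::finite, 'n2::finite, 'n3::{finite,linorder}) tensor"
  shows "norm (bcirc A) = sqrt CARD('n3) * norm A"
proof -
  have "bcirc A \<bullet> bcirc A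
      = (\<Sum>k\<in>UNIV. \<Sum>i\<in>UNIV. \<Sum>l\<in>UNIV. \<Sum>j\<in>UNIV. (A $ cyclic_diff k l $ i $ j)\<^sup>2)"
    by (simp add: inner_vec_def sum_UNIV_prod bcirc_nth power2_eq_square)
  also have "\<dots> = (\<Sum>k\<in>UNIV. \<Sum>l\<in>UNIV. \<Sum>i\<in>UNIV. \<Sum>j\<in>UNIV. (A $ cyclic_diff k l $ i $ j)\<^sup>2)"
    by (intro sum.cong refl sum.swap)
  also have "\<dots> = (\<Sum>k\<in>UNIV. \<Sum>l\<in>UNIV. A $ cyclic_diff k l \<bullet> A $ cyclic_diff k l)"
    by (simp add: inner_vec_def power2_eq_square)
  also have "\<dots> = (\<Sum>l\<in>UNIV. \<Sum>k\<in>UNIV. A $ cyclic_diff k l \<bullet> A $ cyclic_diff k l)"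
    by (rule sum.swap)
  also have "\<dots> = (\<Sum>l\<in>(UNIV :: 'n3 set). \<Sum>k\<in>UNIV. A $ k \<bullet> A $ k)"
    by (intro sum.cong refl sum.reindex_bij_betw[OF bij_cyclic_diff])
  also have "\<dots> = CARD('n3) * (A \<bullet> A)"
    by (simp add: inner_vec_def)
  finally show ?thesis
    by (simp add: norm_eq_sqrt_inner real_sqrt_mult)
qed

section \<open>The arithmetic-geometric mean inequality for tensors\<close>

theorem theorem4p2:
  fixes A :: "('m1::finite, 'n1::finite, 'n3::{finite,linorder}) tensor"
    and X :: "('n1, 'n2::finite, 'n3) tensor"
    and B :: "('m2::finite, 'n2, 'n3) tensor"
  shows "frobenius_norm (A *\<^sub>t X *\<^sub>t ttranspose B)
           \<le> 1 / 2 * frobenius_norm (ttranspose A *\<^sub>t A *\<^sub>t X + X *\<^sub>t ttranspose B *\<^sub>t B)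
         \<and> spectral_norm (A *\<^sub>t X *\<^sub>t ttranspose B)
           \<le> 1 / 2 * spectral_norm (ttranspose A *\<^sub>t A *\<^sub>t X + X *\<^sub>t ttranspose B *\<^sub>t B)"
proof
  let ?S = "A *\<^sub>t X *\<^sub>t ttranspose B" and ?T = "ttranspose A *\<^sub>t A *\<^sub>t X + X *\<^sub>t ttranspose B *\<^sub>t B"
  have S: "bcirc ?S = bcirc A ** bcirc X ** transpose (bcirc B)"
    by (simp add: bcirc_tprod bcirc_ttranspose)
  have T: "bcirc ?T = transpose (bcirc A) ** bcirc A ** bcirc X + bcirc X ** transpose (bcirc B) ** bcirc B"
    by (simp add: bcirc_add bcirc_tprod bcirc_ttranspose)
  have "norm (bcirc ?S) \<le> 1 / 2 * norm (bcirc ?T)"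
    unfolding S T by (rule norm_matrix_arith_geo_mean)
  then have "sqrt CARD('n3) * norm ?S \<le> sqrt CARD('n3) * (1 / 2 * norm ?T)"
    by (simp only: norm_bcirc mult_ac)
  then show "frobenius_norm ?S \<le> 1 / 2 * frobenius_norm ?T"
    unfolding frobenius_norm_eq_norm by (rule mult_left_le_imp_le) simp
  show "spectral_norm ?S \<le> 1 / 2 * spectral_norm ?T"
    unfolding spectral_norm_def S T by (rule onorm_matrix_arith_geo_mean)
qed

end
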